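(* Let $\Gamma$ be a finite graph and let $G\leq\mathrm{Aut}(\Gamma)$. Let $\mathcal{C}(G)$ be the set of cyclic subgroups of $G$, and for $C\in\mathcal{C}(G)$ put $c_G(C):=\sum_{C\leq H\leq G}\frac{1}{|H|}$. Then $$F_{\Gamma}(G;x,y)=\sum_{C\in\mathcal{C}(G)}\varphi(|C|)\,c_G(C)\,P_{\Gamma/C}(x,y),$$ where $\varphi$ is Euler's totient function and, for any generator $g$ of $C$, $P_{\Gamma/C}(x,y):=P_{\Gamma/g}(x,y)$.
   Context: Graphs are finite and undirected; loops are allowed and parallel edges are irrelevant (only adjacency matters). For a graph $\Lambda$, the bivariate chromatic polynomial $P_\Lambda(x,y)$ (Dohmen–Pönitz–Tittmann) is the unique polynomial in $x,y$ such that, for all integers $x\ge y\ge 0$, $P_\Lambda(x,y)$ is the number of maps $c:V(\Lambda)\to\{1,\dots,x\}$ such that for every edge $uv$ of $\Lambda$ (including loops, $u=v$) with $c(u)=c(v)$ one has $c(u)>y$. Thus colours $1,\dots,y$ are "proper", colours $y+1,\dots,x$ are "improper", and a vertex carrying a loop can only receive an improper colour. For $g\in G$, the quotient graph $\Gamma/g$ has as vertices the $\langle g\rangle$-orbits on $V(\Gamma)$; two distinct orbits are adjacent iff at least one edge of $\Gamma$ joins them, and an orbit carries a loop iff some edge of $\Gamma$ has both endpoints in that orbit. Generators of the same cyclic subgroup have the same orbits, so $P_{\Gamma/C}$ does not depend on the chosen generator. The multiorbital bivariate chromatic polynomial of $\Gamma$ relative to $G$ is $$F_\Gamma(G;x,y):=\sum_{H\le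 G}\frac1{|H|}\sum_{h\in H}P_{\Gamma/h}(x,y),$$ the outer sum being over all subgroups $H$ of $G$. Sums over $C\le H\le G$ range over all subgroups $H$ of $G$ containing $C$. Identities are identities of polynomials in $x,y$ with rational coefficients. *)

theory Defs
  imports
    "Graph_Theory.Pair_Digraph"
    "HOL-Algebra.Bij"
    "HOL-Algebra.Elementary_Groups"
    "HOL-Algebra.Group_Action"
    "HOL-Computational_Algebra.Polynomial"
    "HOL-Number_Theory.Totient"
begin

text \<open>
  A finite undirected graph, with loops allowed and parallel edges ignored, is a
  \<^locale>\<open>pair_pseudo_graph\<close>: a finite vertex set with a symmetric adjacency relation on it.
\<close>

section \<open>The bivariate chromatic polynomial\<close>

text \<open>Colours \<open>1, \<dots>, y\<close> are proper, colours \<open>y + 1, \<dots>, x\<close> are improper.\<close>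

definition bivariate_colourings :: "'a pair_pre_digraph \<Rightarrow> nat \<Rightarrow> nat \<Rightarrow> ('a \<Rightarrow> nat) set" where
  "bivariate_colourings \<Lambda> x y =
     {c \<in> pverts \<Lambda> \<rightarrow>\<^sub>E {1..x}. \<forall>u v. (u, v) \<in> parcs \<Lambda> \<longrightarrow> c u = c v \<longrightarrow> y < c u}"

text \<open>
  Elements of \<open>\<rat>[x,y]\<close> are represented as \<open>\<rat>[x][y]\<close>: the coefficients of the outer polynomial
  (in \<open>y\<close>) are polynomials in \<open>x\<close>.
\<close>

definition eval2 :: "rat poly poly \<Rightarrow> rat \<Rightarrow> rat \<Rightarrow> rat" where
  "eval2 P x y = poly (poly P [:y:]) x"

definition bivariate_chromatic_poly :: "'a pair_pre_digraph \<Rightarrow> rat poly poly" where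
  "bivariate_chromatic_poly \<Lambda> =
     (THE P. \<forall>x y. y \<le> x \<longrightarrow>
        eval2 P (of_nat x) (of_nat y) = of_nat (card (bivariate_colourings \<Lambda> x y)))"

text \<open>The polynomial specified above exists and is unique.\<close>

lemma eval2_unique:
  assumes "\<And>x y. y \<le> x \<Longrightarrow> eval2 P (of_nat x) (of_nat y) = eval2 Q (of_nat x) (of_nat y)"
  shows "P = Q"
proof -
  have 1: "poly (P - Q) [:of_nat y:] = 0" for y :: nat
  proof (rule ccontr)
    assume "poly (P - Q) [:of_nat y:] \<noteq> 0"
    then have "finite {x. poly (poly (P - Q) [:of_nat y:]) x = 0}"
      by (rule poly_roots_finite)
    moreover have "of_nat ` {y..} \<subseteq> {x. poly (poly (P - Q) [:of_nat y:]) x = (0::rat)}"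
      using assms by (auto simp: eval2_def)
    ultimately have "finite (of_nat ` {y..} :: rat set)"
      by (rule rev_finite_subset)
    then have "finite {y..}"
      by (rule finite_imageD) (auto simp: inj_on_def)
    then show False by (simp add: infinite_Ici)
  qed
  show ?thesis
  proof (rule ccontr)
    assume "P \<noteq> Q"
    then have "finite {t. poly (P - Q) t = 0}"
      by (intro poly_roots_finite) simp
    moreover have "range (\<lambda>y::nat. [:of_nat y:]) \<subseteq> {t. poly (P - Q) t = 0}"
      using 1 by auto
    ultimately have "finite (range (\<lambda>y::nat. [:of_nat y::rat:]))"
      by (rule rev_finite_subset)
    then have "finite (UNIV :: nat set)"
      by (rule finite_imageD) (auto simp: inj_on_def)
    then show False by simp
  qed
qed

definition poly_fun2 :: "(nat \<Rightarrow> nat \<Rightarrow> nat) \<Rightarrow> bool" where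
  "poly_fun2 f \<longleftrightarrow>
     (\<exists>P. \<forall>x y. y \<le> x \<longrightarrow> eval2 P (of_nat x) (of_nat y) = of_nat (f x y))"

lemma poly_fun2_const: "poly_fun2 (\<lambda>_ _. k)"
  unfolding poly_fun2_def by (rule exI[of _ "[:[:of_nat k:]:]"]) (simp add: eval2_def)

lemma poly_fun2_mult:
  assumes "poly_fun2 f" "poly_fun2 g" shows "poly_fun2 (\<lambda>x y. f x y * g x y)"
proof -
  obtain P Q where
    "\<forall>x y. y \<le> x \<longrightarrow> eval2 P (of_nat x) (of_nat y) = of_nat (f x y)"
    "\<forall>x y. y \<le> x \<longrightarrow> eval2 Q (of_nat x) (of_nat y) = of_nat (g x y)"
    using assms unfolding poly_fun2_def by auto
  then show ?thesis
    unfolding poly_fun2_def by (intro exI[of _ "P * Q"]) (simp add: eval2_def)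
qed

lemma poly_fun2_add:
  assumes "poly_fun2 f" "poly_fun2 g" shows "poly_fun2 (\<lambda>x y. f x y + g x y)"
proof -
  obtain P Q where
    "\<forall>x y. y \<le> x \<longrightarrow> eval2 P (of_nat x) (of_nat y) = of_nat (f x y)"
    "\<forall>x y. y \<le> x \<longrightarrow> eval2 Q (of_nat x) (of_nat y) = of_nat (g x y)"
    using assms unfolding poly_fun2_def by auto
  then show ?thesis
    unfolding poly_fun2_def by (intro exI[of _ "P + Q"]) (simp add: eval2_def)
qed

lemma poly_fun2_sum:
  assumes "\<And>i. i \<in> I \<Longrightarrow> poly_fun2 (f i)" shows "poly_fun2 (\<lambda>x y. \<Sum>i\<in>I. f i x y)"
  using assms
  by (induction I rule: infinite_finite_induct) (auto intro: poly_fun2_const poly_fun2_add)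

lemma poly_fun2_diff_power: "poly_fun2 (\<lambda>x y. (x - y) ^ n)"
proof (induction n)
  case 0
  show ?case using poly_fun2_const[of 1] by simp
next
  case (Suc n)
  have "poly_fun2 (\<lambda>x y. x - y)"
    unfolding poly_fun2_def
    by (rule exI[of _ "[:[:0, 1:], [:-1:]:]"]) (simp add: eval2_def of_nat_diff)
  from poly_fun2_mult[OF this Suc] show ?case by simp
qed

lemma poly_fun2_choose: "poly_fun2 (\<lambda>x y. y choose k)"
proof -
  define P :: "rat poly poly" where
    "P = [:[:1 / fact k:]:] * (\<Prod>i<k. [:[:- of_nat i:], 1:])"
  have "eval2 P (of_nat x) (of_nat y) = of_nat (y choose k)" for x y
    unfolding P_def eval2_def
    by (simp add: poly_prod binomial_gbinomial gbinomial_prod_rev atLeast0LessThan)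
  then show ?thesis unfolding poly_fun2_def by blast
qed

lemma card_proper_colourings:
  fixes E :: "('a \<times> 'a) set" and U :: "'a set" and y :: nat
  assumes "finite U"
  defines "proper \<equiv> \<lambda>S::nat set. {c \<in> U \<rightarrow>\<^sub>E S. \<forall>u\<in>U. \<forall>v\<in>U. (u, v) \<in> E \<longrightarrow> c u \<noteq> c v}"
  shows "card (proper {1..y}) =
    (\<Sum>k\<le>card U. card {c \<in> proper {1..k}. c ` U = {1..k}} * (y choose k))"
proof -
  define s where "s S = {c \<in> proper S. c ` U = S}" for S
  have fin: "finite (s S)" if "finite S" for S
    unfolding s_def proper_def using that assms(1) by (auto intro!: finite_PiE)
  have cards: "card (s S) = card (s {1..k})" if S: "finite S" "card S = k" for S k
  proof -
    obtain h where h: "bij_betw h S {1..k}"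
      using S by (metis finite_same_card_bij card_atLeastAtMost diff_Suc_1 finite_atLeastAtMost)
    let ?g = "inv_into S h"
    have g: "bij_betw ?g {1..k} S" by (rule bij_betw_inv_into[OF h])
    have trans: "(\<lambda>u\<in>U. f (c u)) \<in> s B"
      if f: "bij_betw f A B" and c: "c \<in> s A" for f :: "nat \<Rightarrow> nat" and A B c
    proof -
      have "c ` U = A" and cU: "\<And>u. u \<in> U \<Longrightarrow> c u \<in> A" using c by (auto simp: s_def)
      moreover have "f ` A = B" "inj_on f A" using f by (auto simp: bij_betw_def)
      ultimately show ?thesis
        using c unfolding s_def proper_def by (auto simp: inj_on_eq_iff image_image[symmetric])
    qed
    have ext: "c \<in> extensional U" and mem: "\<And>u. u \<in> U \<Longrightarrow> c u \<in> A" if "c \<in> s A" for c A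
      using that by (auto simp: s_def proper_def PiE_def)
    have "bij_betw (\<lambda>c. \<lambda>u\<in>U. h (c u)) (s S) (s {1..k})"
    proof (rule bij_betw_byWitness[where f' = "\<lambda>c. \<lambda>u\<in>U. ?g (c u)"])
      show "\<forall>c\<in>s S. (\<lambda>u\<in>U. ?g ((\<lambda>u\<in>U. h (c u)) u)) = c"
        using ext mem h by (auto intro!: extensionalityI[of _ U] simp: bij_betw_inv_into_left)
      show "\<forall>c\<in>s {1..k}. (\<lambda>u\<in>U. h ((\<lambda>u\<in>U. ?g (c u)) u)) = c"
        using ext
        by (intro ballI extensionalityI[of _ U]) (auto simp: bij_betw_inv_into_right[OF h] dest: mem)
    qed (use trans[OF h] trans[OF g] in auto)
    then show ?thesis by (rule bij_betw_same_card)
  qed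
  have "proper {1..y} = (\<Union>S\<in>{S. S \<subseteq> {1..y} \<and> card S \<le> card U}. s S)"
  proof (intro equalityI subsetI)
    fix c assume c: "c \<in> proper {1..y}"
    then have "c \<in> s (c ` U)" "c ` U \<subseteq> {1..y}" "card (c ` U) \<le> card U"
      using card_image_le[OF assms(1)] by (auto simp: s_def proper_def PiE_def)
    then show "c \<in> (\<Union>S\<in>{S. S \<subseteq> {1..y} \<and> card S \<le> card U}. s S)" by blast
  next
    fix c assume "c \<in> (\<Union>S\<in>{S. S \<subseteq> {1..y} \<and> card S \<le> card U}. s S)"
    then show "c \<in> proper {1..y}" by (auto simp: s_def proper_def PiE_def Pi_def)
  qed
  moreover have "card (\<Union>S\<in>{S. S \<subseteq> {1..y} \<and> card S \<le> card U}. s S) =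
      (\<Sum>S\<in>{S. S \<subseteq> {1..y} \<and> card S \<le> card U}. card (s S))"
    by (rule card_UN_disjoint) (auto simp: s_def intro!: fin[unfolded s_def] intro: finite_subset)
  moreover have "\<dots> = (\<Sum>k\<le>card U. \<Sum>S\<in>{S \<in> {S. S \<subseteq> {1..y} \<and> card S \<le> card U}. card S = k}. card (s S))"
    by (rule sum.group[symmetric]) auto
  moreover have "\<dots> = (\<Sum>k\<le>card U. card (s {1..k}) * (y choose k))"
  proof (rule sum.cong[OF refl])
    fix k assume k: "k \<in> {..card U}"
    have "(\<Sum>S\<in>{S \<in> {S. S \<subseteq> {1..y} \<and> card S \<le> card U}. card S = k}. card (s S)) =
        (\<Sum>S\<in>{S. S \<subseteq> {1..y} \<and> card S = k}. card (s {1..k}))"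
    proof (rule sum.cong)
      fix S assume "S \<in> {S. S \<subseteq> {1..y} \<and> card S = k}"
      then have "S \<subseteq> {1..y}" "card S = k" by auto
      moreover from this(1) have "finite S" by (rule finite_subset) simp
      ultimately show "card (s S) = card (s {1..k})" by (intro cards)
    qed (use k in auto)
    also have "\<dots> = card (s {1..k}) * (y choose k)"
      using n_subsets[of "{1..y}" k] by simp
    finally show "(\<Sum>S\<in>{S \<in> {S. S \<subseteq> {1..y} \<and> card S \<le> card U}. card S = k}. card (s S)) =
      card (s {1..k}) * (y choose k)" .
  qed
  ultimately show ?thesis by (simp add: s_def)
qed

lemma (in pair_fin_digraph) card_bivariate_colourings:
  assumes "y \<le> x"
  shows "card (bivariate_colourings G x y) =
    (\<Sum>U\<in>Pow (pverts G).
       card {c \<in> U \<rightarrow>\<^sub>E {1..y}. \<forall>u\<in>U. \<forall>v\<in>U. (u, v) \<in> parcs G \<longrightarrow> c u \<noteq> c v} *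
       (x - y) ^ card (pverts G - U))"
proof -
  let ?V = "pverts G"
  define B where "B = bivariate_colourings G x y"
  define L where "L c = {u \<in> ?V. c u \<le> y}" for c :: "'a \<Rightarrow> nat"
  define proper where "proper U = {c \<in> U \<rightarrow>\<^sub>E {1..y}. \<forall>u\<in>U. \<forall>v\<in>U. (u, v) \<in> parcs G \<longrightarrow> c u \<noteq> c v}" for U
  have finB: "finite B"
    unfolding B_def bivariate_colourings_def
    by (rule finite_subset[of _ "?V \<rightarrow>\<^sub>E {1..x}"])
      (use pair_finite_verts in \<open>auto intro!: finite_PiE\<close>)
  have "card B = (\<Sum>U\<in>Pow ?V. card {c \<in> B. L c = U})"
  proof -
    have "L ` B \<subseteq> Pow ?V" by (auto simp: L_def)
    then show ?thesis
      using sum.group[of B "Pow ?V" L "\<lambda>_. 1::nat"] finB pair_finite_verts by simp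
  qed
  also have "\<dots> = (\<Sum>U\<in>Pow ?V. card (proper U) * (x - y) ^ card (?V - U))"
  proof (rule sum.cong[OF refl])
    fix U assume "U \<in> Pow ?V"
    then have U: "U \<subseteq> ?V" "finite U"
      using pair_finite_verts by (auto intro: finite_subset)
    let ?W = "?V - U"
    have "bij_betw (\<lambda>c. (restrict c U, restrict c ?W)) {c \<in> B. L c = U}
        (proper U \<times> (?W \<rightarrow>\<^sub>E {y+1..x}))"
    proof (rule bij_betw_byWitness[where f' = "\<lambda>(a, b). \<lambda>v\<in>?V. if v \<in> U then a v else b v"])
      show "\<forall>c\<in>{c \<in> B. L c = U}.
          (case (restrict c U, restrict c ?W) of (a, b) \<Rightarrow> \<lambda>v\<in>?V. if v \<in> U then a v else b v) = c"
        by (auto simp: B_def bivariate_colourings_def PiE_def intro!: extensionalityI[of _ ?V])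
      show "\<forall>p\<in>proper U \<times> (?W \<rightarrow>\<^sub>E {y+1..x}).
          (restrict (case p of (a, b) \<Rightarrow> \<lambda>v\<in>?V. if v \<in> U then a v else b v) U,
           restrict (case p of (a, b) \<Rightarrow> \<lambda>v\<in>?V. if v \<in> U then a v else b v) ?W) = p"
      proof
        fix p assume "p \<in> proper U \<times> (?W \<rightarrow>\<^sub>E {y+1..x})"
        then obtain a b where p: "p = (a, b)" and ab: "a \<in> extensional U" "b \<in> extensional ?W"
          by (auto simp: proper_def PiE_def)
        have "restrict (\<lambda>v\<in>?V. if v \<in> U then a v else b v) U = a"
          using ab U by (intro extensionalityI[of _ U]) auto
        moreover have "restrict (\<lambda>v\<in>?V. if v \<in> U then a v else b v) ?W = b"
          using ab by (intro extensionalityI[of _ ?W]) auto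
        ultimately show "(restrict (case p of (a, b) \<Rightarrow> \<lambda>v\<in>?V. if v \<in> U then a v else b v) U,
            restrict (case p of (a, b) \<Rightarrow> \<lambda>v\<in>?V. if v \<in> U then a v else b v) ?W) = p"
          by (simp add: p)
      qed
      show "(\<lambda>c. (restrict c U, restrict c ?W)) ` {c \<in> B. L c = U} \<subseteq> proper U \<times> (?W \<rightarrow>\<^sub>E {y+1..x})"
      proof (rule image_subsetI)
        fix c assume "c \<in> {c \<in> B. L c = U}"
        then have c: "c \<in> B" and U_eq: "U = L c" by auto
        have c1: "1 \<le> c u" "c u \<le> x" if "u \<in> ?V" for u
          using c that by (auto simp: B_def bivariate_colourings_def)
        have c2: "y < c u" if "(u, v) \<in> parcs G" "c u = c v" for u v
          using c that by (auto simp: B_def bivariate_colourings_def)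
        have "restrict c U \<in> proper U"
          unfolding proper_def using c1 by (force simp: U_eq L_def dest: c2)
        moreover have "restrict c ?W \<in> ?W \<rightarrow>\<^sub>E {y+1..x}"
          using c1 by (auto simp: U_eq L_def)
        ultimately show "(restrict c U, restrict c ?W) \<in> proper U \<times> (?W \<rightarrow>\<^sub>E {y+1..x})"
          by blast
      qed
      show "(\<lambda>(a, b). \<lambda>v\<in>?V. if v \<in> U then a v else b v) ` (proper U \<times> (?W \<rightarrow>\<^sub>E {y+1..x}))
          \<subseteq> {c \<in> B. L c = U}"
      proof (rule image_subsetI)
        fix p assume "p \<in> proper U \<times> (?W \<rightarrow>\<^sub>E {y+1..x})"
        then obtain a b where p: "p = (a, b)"
          and a: "a \<in> proper U" and b: "b \<in> ?W \<rightarrow>\<^sub>E {y+1..x}"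
          by auto
        let ?c = "\<lambda>v\<in>?V. if v \<in> U then a v else b v"
        have a1: "1 \<le> a u" "a u \<le> y" if "u \<in> U" for u
          using a that by (auto simp: proper_def)
        have a2: "a u \<noteq> a v" if "u \<in> U" "v \<in> U" "(u, v) \<in> parcs G" for u v
          using a that by (auto simp: proper_def)
        have b1: "y < b u" "b u \<le> x" if "u \<in> ?V" "u \<notin> U" for u
          using b that by (auto simp: PiE_def Pi_def)
        have "?c \<in> ?V \<rightarrow>\<^sub>E {1..x}"
        proof (rule PiE_I)
          fix v assume "v \<in> ?V"
          then show "?c v \<in> {1..x}"
            using a1[of v] b1[of v] assms by (cases "v \<in> U") auto
        qed auto
        moreover have "y < ?c u" if e: "(u, v) \<in> parcs G" "?c u = ?c v" for u v
        proof -
          have "u \<in> ?V" "v \<in> ?V" using e(1) in_arcsD1 in_arcsD2 by auto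
          then show ?thesis
            using e a1[of u] a1[of v] a2[of u v] b1[of u] b1[of v] by (auto split: if_splits)
        qed
        moreover have "L ?c = U"
          using a1 b1 U by (auto simp: L_def not_le[symmetric] split: if_splits)
        ultimately have "?c \<in> B" "L ?c = U"
          unfolding B_def bivariate_colourings_def by blast+
        then show "(case p of (a, b) \<Rightarrow> \<lambda>v\<in>?V. if v \<in> U then a v else b v) \<in> {c \<in> B. L c = U}"
          by (simp add: p)
      qed
    qed
    then have "card {c \<in> B. L c = U} = card (proper U \<times> (?W \<rightarrow>\<^sub>E {y+1..x}))"
      by (rule bij_betw_same_card)
    also have "\<dots> = card (proper U) * (x - y) ^ card ?W"
      using pair_finite_verts by (simp add: card_cartesian_product card_PiE)
    finally show "card {c \<in> B. L c = U} = card (proper U) * (x - y) ^ card ?W" .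
  qed
  finally show ?thesis by (simp add: B_def proper_def)
qed

lemma (in pair_fin_digraph) ex1_bivariate_chromatic_poly:
  "\<exists>!P. \<forall>x y. y \<le> x \<longrightarrow>
     eval2 P (of_nat x) (of_nat y) = of_nat (card (bivariate_colourings G x y))"
proof -
  have "poly_fun2 (\<lambda>x y. \<Sum>U\<in>Pow (pverts G).
       card {c \<in> U \<rightarrow>\<^sub>E {1..y}. \<forall>u\<in>U. \<forall>v\<in>U. (u, v) \<in> parcs G \<longrightarrow> c u \<noteq> c v} *
       (x - y) ^ card (pverts G - U))"
  proof (rule poly_fun2_sum)
    fix U assume "U \<in> Pow (pverts G)"
    then have "finite U" using pair_finite_verts by (auto intro: finite_subset)
    show "poly_fun2 (\<lambda>x y.
       card {c \<in> U \<rightarrow>\<^sub>E {1..y}. \<forall>u\<in>U. \<forall>v\<in>U. (u, v) \<in> parcs G \<longrightarrow> c u \<noteq> c v} *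
       (x - y) ^ card (pverts G - U))"
      unfolding card_proper_colourings[OF \<open>finite U\<close>]
      by (intro poly_fun2_mult poly_fun2_sum poly_fun2_const poly_fun2_choose poly_fun2_diff_power)
  qed
  then obtain P where "\<forall>x y. y \<le> x \<longrightarrow>
      eval2 P (of_nat x) (of_nat y) = of_nat (card (bivariate_colourings G x y))"
    unfolding poly_fun2_def by (auto simp: card_bivariate_colourings)
  then show ?thesis by (auto intro: eval2_unique)
qed

lemma (in pair_fin_digraph) eval2_bivariate_chromatic_poly:
  assumes "y \<le> x"
  shows "eval2 (bivariate_chromatic_poly G) (of_nat x) (of_nat y) =
    of_nat (card (bivariate_colourings G x y))"
  using theI'[OF ex1_bivariate_chromatic_poly] assms
  unfolding bivariate_chromatic_poly_def by blast

section \<open>Automorphisms and quotient graphs\<close>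

definition graph_auts :: "'a pair_pre_digraph \<Rightarrow> ('a \<Rightarrow> 'a) set" where
  "graph_auts \<Gamma> = {f \<in> Bij (pverts \<Gamma>).
     \<forall>u\<in>pverts \<Gamma>. \<forall>v\<in>pverts \<Gamma>. (f u, f v) \<in> parcs \<Gamma> \<longleftrightarrow> (u, v) \<in> parcs \<Gamma>}"

definition AutGraph :: "'a pair_pre_digraph \<Rightarrow> ('a \<Rightarrow> 'a) monoid" where
  "AutGraph \<Gamma> = BijGroup (pverts \<Gamma>) \<lparr>carrier := graph_auts \<Gamma>\<rparr>"

lemma group_AutGraph: "group (AutGraph \<Gamma>)"
proof -
  let ?V = "pverts \<Gamma>"
  have "subgroup (graph_auts \<Gamma>) (BijGroup ?V)"
  proof (rule subgroup.intro)
    show "graph_auts \<Gamma> \<subseteq> carrier (BijGroup ?V)"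
      by (auto simp: graph_auts_def BijGroup_def)
    show "\<one>\<^bsub>BijGroup ?V\<^esub> \<in> graph_auts \<Gamma>"
      by (auto simp: graph_auts_def BijGroup_def id_Bij)
  next
    fix f g assume fg: "f \<in> graph_auts \<Gamma>" "g \<in> graph_auts \<Gamma>"
    then have "g u \<in> ?V" if "u \<in> ?V" for u
      using that by (auto simp: graph_auts_def dest: Bij_imp_funcset)
    with fg show "f \<otimes>\<^bsub>BijGroup ?V\<^esub> g \<in> graph_auts \<Gamma>"
      by (auto simp: graph_auts_def BijGroup_def compose_Bij compose_eq)
  next
    fix f assume f: "f \<in> graph_auts \<Gamma>"
    then have fB: "f \<in> Bij ?V" by (simp add: graph_auts_def)
    have fi: "f (inv_into ?V f v) = v" "inv_into ?V f v \<in> ?V" if "v \<in> ?V" for v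
      using fB that Bij_inv_into_mem[OF fB that]
      by (auto simp: Bij_def bij_betw_def intro: f_inv_into_f)
    have "(inv_into ?V f u, inv_into ?V f v) \<in> parcs \<Gamma> \<longleftrightarrow> (u, v) \<in> parcs \<Gamma>"
      if "u \<in> ?V" "v \<in> ?V" for u v
      using f fi[OF that(1)] fi[OF that(2)] by (auto simp: graph_auts_def) metis+
    then show "inv\<^bsub>BijGroup ?V\<^esub> f \<in> graph_auts \<Gamma>"
      using restrict_inv_into_Bij[OF fB] by (simp add: inv_BijGroup[OF fB] graph_auts_def)
  qed
  then show ?thesis
    unfolding AutGraph_def by (rule subgroup.subgroup_is_group[OF _ group_BijGroup])
qed

definition cyclic_orbits :: "'a pair_pre_digraph \<Rightarrow> ('a \<Rightarrow> 'a) \<Rightarrow> 'a set set" where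
  "cyclic_orbits \<Gamma> g = orbits (subgroup_generated (AutGraph \<Gamma>) {g}) (pverts \<Gamma>) (\<lambda>h. h)"

text \<open>The case \<open>A = B\<close> yields the loops of the quotient.\<close>

definition quotient_graph :: "'a pair_pre_digraph \<Rightarrow> ('a \<Rightarrow> 'a) \<Rightarrow> 'a set pair_pre_digraph" where
  "quotient_graph \<Gamma> g =
     \<lparr>pverts = cyclic_orbits \<Gamma> g,
      parcs = {(A, B). A \<in> cyclic_orbits \<Gamma> g \<and> B \<in> cyclic_orbits \<Gamma> g \<and>
        (\<exists>u\<in>A. \<exists>v\<in>B. (u, v) \<in> parcs \<Gamma>)}\<rparr>"

lemma pair_pseudo_graph_quotient_graph:
  assumes "pair_pseudo_graph \<Gamma>"
  shows "pair_pseudo_graph (quotient_graph \<Gamma> g)"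
proof -
  interpret pair_pseudo_graph \<Gamma> by fact
  have fin: "finite (cyclic_orbits \<Gamma> g)"
    using pair_finite_verts by (simp add: cyclic_orbits_def orbits_def)
  have sym: "(v, u) \<in> parcs \<Gamma>" if "(u, v) \<in> parcs \<Gamma>" for u v
    using pair_sym_arcs that by (auto simp: symmetric_def dest: symD)
  show ?thesis
  proof
    show "finite (parcs (quotient_graph \<Gamma> g))"
      by (rule finite_subset[OF _ finite_cartesian_product[OF fin fin]])
        (auto simp: quotient_graph_def)
    show "symmetric (quotient_graph \<Gamma> g)"
      by (auto simp: symmetric_def quotient_graph_def intro!: symI dest: sym)
  qed (use fin in \<open>auto simp: quotient_graph_def\<close>)
qed

section \<open>The multiorbital bivariate chromatic polynomial\<close>

definition multiorbital_poly ::
    "'a pair_pre_digraph \<Rightarrow> ('a \<Rightarrow> 'a) set \<Rightarrow> rat poly poly" where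
  "multiorbital_poly \<Gamma> G =
     (\<Sum>H | subgroup H (AutGraph \<Gamma> \<lparr>carrier := G\<rparr>).
        smult [:1 / of_nat (card H):]
          (\<Sum>h\<in>H. bivariate_chromatic_poly (quotient_graph \<Gamma> h)))"

definition cyclic_subgroups :: "('g, 'b) monoid_scheme \<Rightarrow> 'g set set" where
  "cyclic_subgroups G = {C. subgroup C G \<and> cyclic_group (G\<lparr>carrier := C\<rparr>)}"

definition subgroup_weight :: "('g, 'b) monoid_scheme \<Rightarrow> 'g set \<Rightarrow> rat" where
  "subgroup_weight G C = (\<Sum>H | subgroup H G \<and> C \<subseteq> H. 1 / of_nat (card H))"

end

theory Submission
  imports "HOL-Algebra.Multiplicative_Group" Defs
begin

text \<open>
  The quotient graph of \<open>g\<close> depends only on the orbits of \<open>g\<close>, hence only on the cyclic subgroup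
  \<open>\<langle>g\<rangle>\<close>. So the multiorbital polynomial is a weighted sum over pairs \<open>h \<in> H\<close> whose summand sees \<open>h\<close>
  only through \<open>\<langle>h\<rangle>\<close>. Since \<open>h \<in> H\<close> is equivalent to \<open>\<langle>h\<rangle> \<subseteq> H\<close>, exchanging the two sums attaches to
  each \<open>h\<close> the total weight of the subgroups above \<open>\<langle>h\<rangle>\<close>. This weight, too, depends only on \<open>\<langle>h\<rangle>\<close>, so
  the elements of the group may be collected according to the cyclic subgroup that they generate,
  and a cyclic group of order \<open>n\<close> has \<open>\<phi>(n)\<close> generators. The exchange is a statement about arbitrary
  finite groups, \<open>sum_subgroups_eq_sum_cyclic_subgroups\<close>; the graph enters only through
  \<open>quotient_graph_cong\<close>.
\<close>

context group
begin

lemma mem_subgroup_iff_generate_subset: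
  assumes "subgroup H G"
  shows "h \<in> H \<longleftrightarrow> generate G {h} \<subseteq> H"
  using generate_subgroup_incl[OF _ assms, of "{h}"] generate.incl[of h "{h}" G] by auto

lemma cyclic_subgroups_eq:
  "cyclic_subgroups G = (\<lambda>g. generate G {g}) ` carrier G"
proof (intro equalityI subsetI)
  fix C assume "C \<in> cyclic_subgroups G"
  then obtain g where C: "subgroup C G" and g: "g \<in> C"
    and gen: "subgroup_generated (G\<lparr>carrier := C\<rparr>) {g} = G\<lparr>carrier := C\<rparr>"
    by (auto simp: cyclic_subgroups_def cyclic_group_def)
  from arg_cong[OF gen, of carrier] g have "generate (G\<lparr>carrier := C\<rparr>) {g} = C"
    by (simp add: carrier_subgroup_generated)
  then have "generate G {g} = C"
    using generate_consistent[of "{g}" C] C g by simp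
  then show "C \<in> (\<lambda>g. generate G {g}) ` carrier G"
    using g subgroup.mem_carrier[OF C] by blast
next
  fix C assume "C \<in> (\<lambda>g. generate G {g}) ` carrier G"
  then obtain g where g: "g \<in> carrier G" and C: "C = generate G {g}" by auto
  have sub: "subgroup C G" using g by (simp add: C generate_is_subgroup)
  have gC: "g \<in> C" by (simp add: C generate.incl)
  have "generate (G\<lparr>carrier := C\<rparr>) {g} = C"
    using generate_consistent[of "{g}" C] sub gC by (simp add: C)
  then have "subgroup_generated (G\<lparr>carrier := C\<rparr>) {g} = G\<lparr>carrier := C\<rparr>"
    using gC by (simp add: subgroup_generated_def)
  then show "C \<in> cyclic_subgroups G"
    using sub gC by (auto simp: cyclic_subgroups_def cyclic_group_def)
qed

text \<open>
  The elements of \<open>\<langle>a\<rangle>\<close> are the powers \<open>a\<^sup>k\<close> with \<open>1 \<le> k \<le> n\<close>, where \<open>n\<close> is the order of \<open>a\<close>. By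
  cardinality \<open>a\<^sup>k\<close> generates \<open>\<langle>a\<rangle>\<close> iff it also has order \<open>n\<close>, that is, iff \<open>k\<close> is a totative of \<open>n\<close>.
\<close>

lemma card_generators_eq_totient:
  assumes fin: "finite (carrier G)" and a: "a \<in> carrier G"
  shows "card {h \<in> carrier G. generate G {h} = generate G {a}} = totient (card (generate G {a}))"
proof -
  let ?n = "ord a"
  have n: "?n \<ge> 1" by (rule ord_ge_1[OF fin a])
  have "{h \<in> carrier G. generate G {h} = generate G {a}} = (\<lambda>k. a [^] k) ` totatives ?n"
  proof (intro equalityI subsetI)
    fix h assume "h \<in> {h \<in> carrier G. generate G {h} = generate G {a}}"
    then have h: "h \<in> carrier G" and eq: "generate G {h} = generate G {a}" by auto
    have "h \<in> {a [^] k | k. k \<in> (UNIV :: nat set)}"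
      using generate_pow_on_finite_carrier[OF fin a] eq generate.incl[of h "{h}" G] by simp
    then obtain k :: nat where "k \<in> {0..?n - 1}" and hk: "h = a [^] k"
      unfolding ord_elems[OF fin a] by blast
    with n have k: "k < ?n" by simp
    \<comment> \<open>Totatives lie in \<open>{1..n}\<close>, whereas the exponents found above lie in \<open>{0..n - 1}\<close>.\<close>
    define l where "l = (if k = 0 then ?n else k)"
    have l: "0 < l" "l \<le> ?n" "h = a [^] l"
      using k hk n a by (auto simp: l_def)
    have "ord h = ?n"
      using eq by (simp add: generate_pow_card h a)
    then have "coprime l ?n"
      using pow_ord_eq_ord_iff[OF fin a] l(3) by simp
    with l show "h \<in> (\<lambda>k. a [^] k) ` totatives ?n"
      by (auto simp: in_totatives_iff)
  next
    fix h assume "h \<in> (\<lambda>k. a [^] k) ` totatives ?n"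
    then obtain k :: nat where k: "coprime k ?n" and h: "h = a [^] k"
      by (auto simp: in_totatives_iff)
    have hG: "h \<in> carrier G" using a by (simp add: h)
    have sub: "subgroup (generate G {a}) G" using a by (simp add: generate_is_subgroup)
    have "h \<in> generate G {a}"
      unfolding generate_pow_on_finite_carrier[OF fin a] by (auto simp: h)
    then have "generate G {h} \<subseteq> generate G {a}"
      using mem_subgroup_iff_generate_subset[OF sub] by simp
    moreover have "card (generate G {h}) = card (generate G {a})"
      using pow_ord_eq_ord_iff[OF fin a] k by (simp add: generate_pow_card[symmetric] hG a h)
    moreover have "finite (generate G {a})"
      using fin subgroup.subset[OF sub] by (rule rev_finite_subset)
    ultimately have "generate G {h} = generate G {a}"
      by (intro card_subset_eq)
    with hG show "h \<in> {h \<in> carrier G. generate G {h} = generate G {a}}" by simp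
  qed
  moreover have "inj_on (\<lambda>k. a [^] k) (totatives ?n)"
    by (rule inj_on_subset[OF ord_inj'[OF a]]) (auto simp: in_totatives_iff)
  ultimately show ?thesis
    by (simp add: card_image totient_def generate_pow_card[OF a])
qed

lemma sum_generate_eq_sum_cyclic_subgroups:
  fixes f :: "'a set \<Rightarrow> 'r::semiring_1"
  assumes fin: "finite (carrier G)"
  shows "(\<Sum>h\<in>carrier G. f (generate G {h})) =
    (\<Sum>C\<in>cyclic_subgroups G. of_nat (totient (card C)) * f C)"
proof -
  have "(\<Sum>h\<in>carrier G. f (generate G {h})) =
      (\<Sum>C\<in>cyclic_subgroups G. \<Sum>h\<in>{h \<in> carrier G. generate G {h} = C}. f (generate G {h}))"
    by (rule sum.group[symmetric]) (auto simp: fin cyclic_subgroups_eq)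
  also have "\<dots> = (\<Sum>C\<in>cyclic_subgroups G. of_nat (totient (card C)) * f C)"
    by (rule sum.cong) (auto simp: cyclic_subgroups_eq card_generators_eq_totient[OF fin])
  finally show ?thesis .
qed

text \<open>
  The weight \<open>w\<close> is kept arbitrary because the exchange of summation uses only that \<open>h \<in> H\<close> is
  equivalent to \<open>\<langle>h\<rangle> \<subseteq> H\<close>; the choice \<open>w H = 1 / |H|\<close> averages over each subgroup.
\<close>

theorem sum_subgroups_eq_sum_cyclic_subgroups:
  fixes w f :: "'a set \<Rightarrow> 'r::semiring_1"
  assumes fin: "finite (carrier G)"
  shows "(\<Sum>H | subgroup H G. w H * (\<Sum>h\<in>H. f (generate G {h}))) =
    (\<Sum>C\<in>cyclic_subgroups G.
       of_nat (totient (card C)) * (\<Sum>H | subgroup H G \<and> C \<subseteq> H. w H) * f C)"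
proof -
  have fin_sub: "finite {H. subgroup H G}"
    by (rule finite_subset[of _ "Pow (carrier G)"]) (auto simp: fin dest: subgroup.subset)
  have "(\<Sum>H | subgroup H G. w H * (\<Sum>h\<in>H. f (generate G {h}))) =
      (\<Sum>H | subgroup H G. \<Sum>h | h \<in> carrier G \<and> h \<in> H. w H * f (generate G {h}))"
    by (rule sum.cong)
      (auto simp: sum_distrib_left intro!: sum.cong dest: subgroup.mem_carrier)
  also have "\<dots> = (\<Sum>h\<in>carrier G. \<Sum>H | H \<in> {H. subgroup H G} \<and> h \<in> H. w H * f (generate G {h}))"
    by (rule sum.swap_restrict[OF fin_sub fin])
  also have "\<dots> = (\<Sum>h\<in>carrier G.
      (\<Sum>H | subgroup H G \<and> generate G {h} \<subseteq> H. w H) * f (generate G {h}))"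
  proof (rule sum.cong[OF refl])
    fix h
    have "{H. H \<in> {H. subgroup H G} \<and> h \<in> H} = {H. subgroup H G \<and> generate G {h} \<subseteq> H}"
      using mem_subgroup_iff_generate_subset by blast
    then show "(\<Sum>H | H \<in> {H. subgroup H G} \<and> h \<in> H. w H * f (generate G {h})) =
        (\<Sum>H | subgroup H G \<and> generate G {h} \<subseteq> H. w H) * f (generate G {h})"
      by (simp only: sum_distrib_right)
  qed
  also have "\<dots> = (\<Sum>C\<in>cyclic_subgroups G.
      of_nat (totient (card C)) * (\<Sum>H | subgroup H G \<and> C \<subseteq> H. w H) * f C)"
    unfolding sum_generate_eq_sum_cyclic_subgroups
        [OF fin, of "\<lambda>C. (\<Sum>H | subgroup H G \<and> C \<subseteq> H. w H) * f C"]
    by (simp add: mult.assoc)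
  finally show ?thesis .
qed

end

lemma finite_graph_auts:
  assumes "finite (pverts \<Gamma>)"
  shows "finite (graph_auts \<Gamma>)"
proof (rule finite_subset)
  show "graph_auts \<Gamma> \<subseteq> pverts \<Gamma> \<rightarrow>\<^sub>E pverts \<Gamma>"
    by (auto simp: graph_auts_def PiE_def dest: Bij_imp_extensional Bij_imp_funcset)
qed (use assms in \<open>simp add: finite_PiE\<close>)

lemma quotient_graph_cong:
  assumes "g \<in> carrier (AutGraph \<Gamma>)" "h \<in> carrier (AutGraph \<Gamma>)"
    and "generate (AutGraph \<Gamma>) {g} = generate (AutGraph \<Gamma>) {h}"
  shows "quotient_graph \<Gamma> g = quotient_graph \<Gamma> h"
proof -
  have "cyclic_orbits \<Gamma> g = cyclic_orbits \<Gamma> h"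
    using assms by (simp add: cyclic_orbits_def subgroup_generated_def)
  then show ?thesis by (simp add: quotient_graph_def)
qed

theorem proposition3p5:
  fixes \<Gamma> :: "'a pair_pre_digraph"
    and G :: "('a \<Rightarrow> 'a) set"
    and gen :: "('a \<Rightarrow> 'a) set \<Rightarrow> 'a \<Rightarrow> 'a"
  assumes "pair_pseudo_graph \<Gamma>"
    and "subgroup G (AutGraph \<Gamma>)"
    and "\<And>C. C \<in> cyclic_subgroups (AutGraph \<Gamma> \<lparr>carrier := G\<rparr>) \<Longrightarrow>
           gen C \<in> C \<and> generate (AutGraph \<Gamma>) {gen C} = C"
  shows "multiorbital_poly \<Gamma> G =
    (\<Sum>C\<in>cyclic_subgroups (AutGraph \<Gamma> \<lparr>carrier := G\<rparr>).
       smult [:of_nat (totient (card C)) * subgroup_weight (AutGraph \<Gamma> \<lparr>carrier := G\<rparr>) C:]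
         (bivariate_chromatic_poly (quotient_graph \<Gamma> (gen C))))"
proof -
  let ?A = "AutGraph \<Gamma>"
  let ?K = "?A \<lparr>carrier := G\<rparr>"
  interpret A: group ?A by (rule group_AutGraph)
  interpret K: group ?K by (rule A.subgroup_imp_group[OF assms(2)])
  interpret pair_pseudo_graph \<Gamma> by fact
  have GA: "G \<subseteq> carrier ?A" by (rule subgroup.subset[OF assms(2)])
  then have fin: "finite (carrier ?K)"
    using finite_graph_auts[OF pair_finite_verts] by (auto simp: AutGraph_def intro: finite_subset)
  have gen_K: "generate ?K {h} = generate ?A {h}" if "h \<in> G" for h
    using A.generate_consistent[OF _ assms(2), of "{h}"] that by simp
  \<comment> \<open>Elements of \<open>\<rat>\<close> acting by \<open>smult\<close> are viewed as constants of \<open>\<rat>[x][y]\<close>.\<close>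
  define w :: "('a \<Rightarrow> 'a) set \<Rightarrow> rat poly poly" where "w H = [:[:1 / of_nat (card H):]:]" for H
  define P where "P C = bivariate_chromatic_poly (quotient_graph \<Gamma> (gen C))" for C
  have P: "bivariate_chromatic_poly (quotient_graph \<Gamma> h) = P (generate ?K {h})" if h: "h \<in> G" for h
  proof -
    let ?C = "generate ?K {h}"
    have C: "?C \<in> cyclic_subgroups ?K"
      using h by (simp add: K.cyclic_subgroups_eq)
    then have "?C \<subseteq> G"
      using subgroup.subset[of ?C ?K] by (simp add: cyclic_subgroups_def)
    then have "gen ?C \<in> carrier ?A" "generate ?A {gen ?C} = generate ?A {h}"
      using assms(3)[OF C] GA gen_K[OF h] by auto
    then show ?thesis
      unfolding P_def using h GA
      by (intro arg_cong[of _ _ bivariate_chromatic_poly] quotient_graph_cong) auto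
  qed
  have weight: "(\<Sum>H | subgroup H ?K \<and> C \<subseteq> H. w H) = [:[:subgroup_weight ?K C:]:]" for C
  proof -
    have "(\<Sum>H\<in>S. w H) = [:[:\<Sum>H\<in>S. 1 / of_nat (card H):]:]" for S
      by (induction S rule: infinite_finite_induct) (auto simp: w_def)
    then show ?thesis by (simp add: subgroup_weight_def)
  qed
  have "multiorbital_poly \<Gamma> G = (\<Sum>H | subgroup H ?K. w H * (\<Sum>h\<in>H. P (generate ?K {h})))"
    unfolding multiorbital_poly_def
  proof (rule sum.cong[OF refl])
    fix H assume "H \<in> {H. subgroup H ?K}"
    then have "H \<subseteq> G" using subgroup.subset by fastforce
    then have "(\<Sum>h\<in>H. bivariate_chromatic_poly (quotient_graph \<Gamma> h)) =
        (\<Sum>h\<in>H. P (generate ?K {h}))"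
      by (intro sum.cong) (auto simp: P)
    then show "smult [:1 / of_nat (card H):]
        (\<Sum>h\<in>H. bivariate_chromatic_poly (quotient_graph \<Gamma> h)) =
        w H * (\<Sum>h\<in>H. P (generate ?K {h}))"
      by (simp add: w_def)
  qed
  also have "\<dots> = (\<Sum>C\<in>cyclic_subgroups ?K. of_nat (totient (card C)) *
      (\<Sum>H | subgroup H ?K \<and> C \<subseteq> H. w H) * P C)"
    by (rule K.sum_subgroups_eq_sum_cyclic_subgroups[OF fin])
  also have "\<dots> = (\<Sum>C\<in>cyclic_subgroups ?K.
      smult [:of_nat (totient (card C)) * subgroup_weight ?K C:] (P C))"
    by (simp add: weight of_nat_poly)
  finally show ?thesis by (simp add: P_def)
qed

end
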